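(* Let $C$ be a finite (universal) algebra and let $A,B\le C$ be subalgebras. Let $A_1,\dots,A_m$ be representatives of all the orbits $O_{A_1},\dots,O_{A_m}$ of the action of $\mathrm{Aut}(C)$ on the set of subalgebras of $C$ isomorphic to $A$, and similarly let $B_1,\dots,B_n$ be representatives of all the orbits of $\mathrm{Aut}(C)$ on the set of subalgebras of $C$ isomorphic to $B$. Then (1) $\mathcal H_C(A|B)=\sum_{j=1}^n \mathcal H_C^*(A|B_j)$; (2) $\mathcal H_B(A)\cdot|O_B|=\sum_{i=1}^m |O_{A_i}|\cdot\mathcal H_C^*(A_i|B)$; (3) $\mathcal H_B(A)\cdot\mathcal H_C(B)=\sum_{i=1}^m |O_{A_i}|\cdot\mathcal H_C(A_i|B)$. When $\mathrm{Aut}(C)$ acts transitively on the subalgebras of $C$ isomorphic to $B$ (i.e., $n=1$), (2) coincides with (3). When $\mathrm{Aut}(C)$ acts transitively on the subalgebras of $C$ isomorphic to $A$ (i.e., $m=1$), then (4) $\mathcal H_B(A)\cdot|O_B|=\mathcal H_C(A)\cdot\mathcal H_C^*(A|B)$; (5) $\mathcal H_B(A)\cdot\mathcal H_C(B)=\mathcal H_C(A)\cdot\mathcal H_C(A|B)$.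
   Context: All algebras are finite universal algebras (of a common type). For $X\le C$, $O_X$ denotes the orbit of $X$ under the natural action of $\mathrm{Aut}(C)$ on the set of subalgebras of $C$ isomorphic to $X$. For algebras $A,B,C$ define (Hasse constants): $\mathcal H_C(B)=|\{B_0\le C:\ B_0\cong B\}|$; for $A\le C$, $\mathcal H_C(A|B)=|\{B_0\le C:\ A\le B_0\cong B\}|$; for $A,B\le C$, $\mathcal H_C^*(A|B)=|\{B_0\le C:\ A\le B_0,\ B_0\in O_B\}|$. *)

theory Defs
  imports "HOL-Algebra.Group_Action"
begin

text \<open>The operation symbols form a set rather than a whole type, so that the signature
  without operation symbols is included. An operation takes the list of its arguments; its
  values on lists of the wrong length or with entries outside the carrier are irrelevant.\<close>

record 'f signature =
  symbols :: "'f set"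
  arity :: "'f \<Rightarrow> nat"

record ('a, 'f) ualg = "'a partial_object" +
  op :: "'f \<Rightarrow> 'a list \<Rightarrow> 'a"

definition args :: "'f signature \<Rightarrow> 'f \<Rightarrow> 'a set \<Rightarrow> 'a list set" where
  "args S f X = {xs. length xs = arity S f \<and> set xs \<subseteq> X}"

definition ualgebra :: "'f signature \<Rightarrow> ('a, 'f) ualg \<Rightarrow> bool" where
  "ualgebra S C \<longleftrightarrow>
     (\<forall>f \<in> symbols S. \<forall>xs \<in> args S f (carrier C). op C f xs \<in> carrier C)"

text \<open>A subalgebra is represented by its universe \<open>X\<close>; as an algebra it is \<open>subalg C X\<close>.
  The empty set is a subalgebra if there are no constants. The convention that excludes it
  is covered as well: a nonempty algebra is not isomorphic to the empty one, so the two
  conventions give the same numbers whenever the given subalgebras are nonempty.\<close>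

definition is_subalgebra :: "'f signature \<Rightarrow> 'a set \<Rightarrow> ('a, 'f) ualg \<Rightarrow> bool" where
  "is_subalgebra S X C \<longleftrightarrow> X \<subseteq> carrier C \<and>
     (\<forall>f \<in> symbols S. \<forall>xs \<in> args S f X. op C f xs \<in> X)"

definition subalg :: "('a, 'f) ualg \<Rightarrow> 'a set \<Rightarrow> ('a, 'f) ualg" where
  "subalg C X = C\<lparr>carrier := X\<rparr>"

definition ua_hom :: "'f signature \<Rightarrow> ('a, 'f) ualg \<Rightarrow> ('b, 'f) ualg \<Rightarrow> ('a \<Rightarrow> 'b) set" where
  "ua_hom S A B = {h \<in> carrier A \<rightarrow> carrier B.
     \<forall>f \<in> symbols S. \<forall>xs \<in> args S f (carrier A). h (op A f xs) = op B f (map h xs)}"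

definition ua_isomorphic :: "'f signature \<Rightarrow> ('a, 'f) ualg \<Rightarrow> ('b, 'f) ualg \<Rightarrow> bool" where
  "ua_isomorphic S A B \<longleftrightarrow> (\<exists>h \<in> ua_hom S A B. bij_betw h (carrier A) (carrier B))"

definition ua_Aut :: "'f signature \<Rightarrow> ('a, 'f) ualg \<Rightarrow> ('a \<Rightarrow> 'a) monoid" where
  "ua_Aut S C = BijGroup (carrier C)\<lparr>carrier := ua_hom S C C \<inter> Bij (carrier C)\<rparr>"

definition copies :: "'f signature \<Rightarrow> ('a, 'f) ualg \<Rightarrow> ('b, 'f) ualg \<Rightarrow> 'a set set" where
  "copies S C B = {B\<^sub>0. is_subalgebra S B\<^sub>0 C \<and> ua_isomorphic S (subalg C B\<^sub>0) B}"

text \<open>The natural action of the automorphism group on the set of subalgebras of \<open>C\<close>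
  isomorphic to \<open>X\<close>; the restriction makes its values elements of the group \<open>BijGroup\<close>
  of extensional bijections.\<close>

definition aut_action ::
    "'f signature \<Rightarrow> ('a, 'f) ualg \<Rightarrow> 'a set \<Rightarrow> ('a \<Rightarrow> 'a) \<Rightarrow> 'a set \<Rightarrow> 'a set" where
  "aut_action S C X h = (\<lambda>Y \<in> copies S C (subalg C X). h ` Y)"

definition aut_orbit :: "'f signature \<Rightarrow> ('a, 'f) ualg \<Rightarrow> 'a set \<Rightarrow> 'a set set" where
  "aut_orbit S C X = orbit (ua_Aut S C) (aut_action S C X) X"

definition aut_orbits :: "'f signature \<Rightarrow> ('a, 'f) ualg \<Rightarrow> 'a set \<Rightarrow> 'a set set set" where
  "aut_orbits S C X = orbits (ua_Aut S C) (copies S C (subalg C X)) (aut_action S C X)"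

definition aut_transitive :: "'f signature \<Rightarrow> ('a, 'f) ualg \<Rightarrow> 'a set \<Rightarrow> bool" where
  "aut_transitive S C X \<longleftrightarrow>
     transitive_action (ua_Aut S C) (copies S C (subalg C X)) (aut_action S C X)"

definition hasse :: "'f signature \<Rightarrow> ('a, 'f) ualg \<Rightarrow> ('b, 'f) ualg \<Rightarrow> nat" where
  "hasse S C B = card (copies S C B)"

definition hasse_over ::
    "'f signature \<Rightarrow> ('a, 'f) ualg \<Rightarrow> 'a set \<Rightarrow> ('b, 'f) ualg \<Rightarrow> nat" where
  "hasse_over S C A B = card {B\<^sub>0. is_subalgebra S B\<^sub>0 C \<and>
     is_subalgebra S A (subalg C B\<^sub>0) \<and> ua_isomorphic S (subalg C B\<^sub>0) B}"

definition hasse_over_star ::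
    "'f signature \<Rightarrow> ('a, 'f) ualg \<Rightarrow> 'a set \<Rightarrow> 'a set \<Rightarrow> nat" where
  "hasse_over_star S C A B = card {B\<^sub>0. is_subalgebra S B\<^sub>0 C \<and>
     is_subalgebra S A (subalg C B\<^sub>0) \<and> B\<^sub>0 \<in> aut_orbit S C B}"

definition orbit_representatives ::
    "'f signature \<Rightarrow> ('a, 'f) ualg \<Rightarrow> 'a set \<Rightarrow> (nat \<Rightarrow> 'a set) \<Rightarrow> nat \<Rightarrow> bool" where
  "orbit_representatives S C X Xs k \<longleftrightarrow>
     (\<forall>i \<in> {1..k}. Xs i \<in> copies S C (subalg C X)) \<and>
     bij_betw (\<lambda>i. aut_orbit S C (Xs i)) {1..k} (aut_orbits S C X)"

end

theory Submission
  imports Defs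
begin

text \<open>All the identities come from counting pairs of subalgebras. Let \<open>\<B>\<close> be a set of
  subalgebras of \<open>C\<close> isomorphic to \<open>B\<close> that is invariant under \<open>Aut(C)\<close>, and count the
  pairs \<open>A\<^sub>0 \<le> B\<^sub>0\<close> with \<open>A\<^sub>0 \<cong> A\<close> and \<open>B\<^sub>0 \<in> \<B>\<close>. For a fixed \<open>B\<^sub>0\<close> an isomorphism
  \<open>B\<^sub>0 \<cong> B\<close> carries the copies of \<open>A\<close> in \<open>B\<^sub>0\<close> to those in \<open>B\<close>, so that there are as many pairs
  as the product of \<open>\<H>\<^sub>B(A)\<close> and \<open>\<bar>\<B>\<bar>\<close>. For a fixed \<open>A\<^sub>0\<close>, the number of \<open>B\<^sub>0 \<in> \<B>\<close> above \<open>A\<^sub>0\<close>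
  depends only on the orbit of \<open>A\<^sub>0\<close>, because automorphisms permute \<open>\<B>\<close> and preserve
  inclusion; so the same number is a sum over the orbits of copies of \<open>A\<close>. This is lemma
  \<open>count_copies_below_invariant_set\<close>.

  The orbit \<open>O\<^sub>B\<close> and the set of all copies of \<open>B\<close> are both invariant, which gives the two
  formulas with a sum over \<open>A\<^sub>1, \<dots>, A\<^sub>m\<close>. The formula for \<open>\<H>\<^sub>C(A|B)\<close> only splits the copies
  of \<open>B\<close> above \<open>A\<close> into orbits. An action on a nonempty set is transitive exactly if it has a
  single orbit; then \<open>O\<^sub>B\<close>, or \<open>O\<^sub>A\<close>, consists of all the copies, and in the case of \<open>A\<close> the
  sums have a single term, with \<open>A\<close> as the representative.\<close>

section \<open>Sums over orbit representatives\<close>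

lemma (in group_action) sum_by_orbit_representatives:
  assumes "finite E" and bij: "bij_betw (\<lambda>i. orbit G \<phi> (r i)) I (orbits G E \<phi>)"
  shows "sum f E = (\<Sum>i\<in>I. sum f (orbit G \<phi> (r i)))"
  using disjoint_sum[OF \<open>finite E\<close>, of f] sum.reindex_bij_betw[OF bij, of "sum f"] by simp

lemma (in group_action) orbit_subset: "x \<in> E \<Longrightarrow> orbit G \<phi> x \<subseteq> E"
  using element_image by (auto simp: orbit_def)

lemma (in group_action) orbit_eq_of_card_orbits_1:
  assumes "card (orbits G E \<phi>) = 1" and "x \<in> E"
  shows "orbit G \<phi> x = E"
proof -
  from assms(1) obtain orb where orb: "orbits G E \<phi> = {orb}"
    by (auto simp: card_1_singleton_iff)
  have "orbit G \<phi> x \<in> orbits G E \<phi>"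
    using assms(2) by (auto simp: orbits_def)
  with orb orbits_coverture show ?thesis
    by simp
qed

lemma (in group_action) transitive_iff_card_orbits:
  assumes "E \<noteq> {}"
  shows "transitive_action G E \<phi> \<longleftrightarrow> card (orbits G E \<phi>) = 1"
proof
  assume "transitive_action G E \<phi>"
  then show "card (orbits G E \<phi>) = 1"
    using transitive_action.one_orbit assms by blast
next
  assume one: "card (orbits G E \<phi>) = 1"
  show "transitive_action G E \<phi>"
  proof
    fix x y assume "x \<in> E" "y \<in> E"
    then have "y \<in> orbit G \<phi> x"
      using orbit_eq_of_card_orbits_1[OF one] by simp
    then show "\<exists>g\<in>carrier G. \<phi> g x = y"
      by (auto simp: orbit_def)
  qed
qed

section \<open>Subalgebras and isomorphisms\<close>

lemma carrier_subalg [simp]: "carrier (subalg C X) = X"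
  and op_subalg [simp]: "op (subalg C X) = op C"
  and subalg_subalg [simp]: "subalg (subalg C X) Y = subalg C Y"
  by (simp_all add: subalg_def)

lemma is_subalgebra_of_subalg:
  assumes "Y \<subseteq> carrier C"
  shows "is_subalgebra S X (subalg C Y) \<longleftrightarrow> is_subalgebra S X C \<and> X \<subseteq> Y"
  using assms by (auto simp: is_subalgebra_def)

lemma is_subalgebra_subset: "is_subalgebra S X C \<Longrightarrow> X \<subseteq> carrier C"
  by (simp add: is_subalgebra_def)

lemma ualgebra_subalg: "is_subalgebra S X C \<Longrightarrow> ualgebra S (subalg C X)"
  by (simp add: is_subalgebra_def ualgebra_def)

lemma args_mono: "xs \<in> args S f X \<Longrightarrow> X \<subseteq> Y \<Longrightarrow> xs \<in> args S f Y"
  by (auto simp: args_def)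

lemma map_args: "xs \<in> args S f X \<Longrightarrow> h ` X \<subseteq> Y \<Longrightarrow> map h xs \<in> args S f Y"
  by (auto simp: args_def)

lemma args_imageE:
  assumes "ys \<in> args S f (h ` X)"
  obtains xs where "xs \<in> args S f X" and "ys = map h xs"
proof -
  have "ys \<in> lists (h ` X)"
    using assms by (auto simp: args_def)
  then obtain xs where "xs \<in> lists X" "ys = map h xs"
    by (auto simp: lists_image)
  with assms that show thesis
    by (auto simp: args_def)
qed

lemma ua_hom_apply:
  assumes "h \<in> ua_hom S A B" "f \<in> symbols S" "xs \<in> args S f (carrier A)"
  shows "h (op A f xs) = op B f (map h xs)"
  using assms by (simp add: ua_hom_def)

lemma ua_hom_image: "h \<in> ua_hom S A B \<Longrightarrow> h ` carrier A \<subseteq> carrier B"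
  by (auto simp: ua_hom_def)

lemma ua_isomorphic_refl: "ua_isomorphic S A A"
  unfolding ua_isomorphic_def by (rule bexI[of _ id]) (auto simp: ua_hom_def)

lemma ua_hom_comp:
  assumes "g \<in> ua_hom S A B" and "h \<in> ua_hom S B D"
  shows "h \<circ> g \<in> ua_hom S A D"
proof -
  have "(h \<circ> g) (op A f xs) = op D f (map (h \<circ> g) xs)"
    if f: "f \<in> symbols S" and xs: "xs \<in> args S f (carrier A)" for f xs
    using ua_hom_apply[OF assms(1) f xs]
      ua_hom_apply[OF assms(2) f map_args[OF xs ua_hom_image[OF assms(1)]]] by simp
  then show ?thesis
    using assms by (auto simp: ua_hom_def)
qed

lemma ua_isomorphic_trans:
  "ua_isomorphic S A B \<Longrightarrow> ua_isomorphic S B D \<Longrightarrow> ua_isomorphic S A D"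
  unfolding ua_isomorphic_def using ua_hom_comp bij_betw_trans by blast

lemma ua_hom_inv_into:
  assumes A: "ualgebra S A" and h: "h \<in> ua_hom S A B"
    and bij: "bij_betw h (carrier A) (carrier B)"
  shows "inv_into (carrier A) h \<in> ua_hom S B A"
proof -
  let ?k = "inv_into (carrier A) h"
  have onto: "h ` carrier A = carrier B" and inj: "inj_on h (carrier A)"
    using bij by (auto simp: bij_betw_def)
  have "?k (op B f ys) = op A f (map ?k ys)"
    if f: "f \<in> symbols S" and ys: "ys \<in> args S f (carrier B)" for f ys
  proof -
    from ys obtain xs where xs: "xs \<in> args S f (carrier A)" "ys = map h xs"
      unfolding onto[symmetric] by (rule args_imageE)
    have "?k (op B f ys) = ?k (h (op A f xs))"
      using ua_hom_apply[OF h f xs(1)] xs(2) by simp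
    also have "\<dots> = op A f xs"
      using A f xs(1) inj by (simp add: ualgebra_def)
    also have "xs = map ?k ys"
      using xs inj by (auto simp: args_def map_idI subset_iff)
    finally show ?thesis .
  qed
  then show ?thesis
    using onto by (auto simp: ua_hom_def inv_into_into)
qed

lemma ua_isomorphic_sym:
  "ualgebra S A \<Longrightarrow> ua_isomorphic S A B \<Longrightarrow> ua_isomorphic S B A"
  unfolding ua_isomorphic_def using ua_hom_inv_into bij_betw_inv_into by blast

lemma is_subalgebra_image:
  assumes h: "h \<in> ua_hom S A B" and X: "is_subalgebra S X A"
  shows "is_subalgebra S (h ` X) B"
  unfolding is_subalgebra_def
proof (intro conjI ballI)
  show "h ` X \<subseteq> carrier B"
    using is_subalgebra_subset[OF X] ua_hom_image[OF h] by blast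
next
  fix f ys assume f: "f \<in> symbols S" and "ys \<in> args S f (h ` X)"
  then obtain xs where xs: "xs \<in> args S f X" "ys = map h xs"
    by (auto elim: args_imageE)
  have "h (op A f xs) = op B f ys"
    using ua_hom_apply[OF h f] args_mono[OF xs(1) is_subalgebra_subset[OF X]] xs(2) by simp
  moreover have "op A f xs \<in> X"
    using X f xs(1) by (simp add: is_subalgebra_def)
  ultimately show "op B f ys \<in> h ` X"
    by (metis imageI)
qed

lemma subalg_isomorphic_image:
  assumes h: "h \<in> ua_hom S A B" and inj: "inj_on h (carrier A)" and X: "X \<subseteq> carrier A"
  shows "ua_isomorphic S (subalg A X) (subalg B (h ` X))"
proof -
  have "h \<in> ua_hom S (subalg A X) (subalg B (h ` X))"
    using ua_hom_apply[OF h _ args_mono[OF _ X]] by (simp add: ua_hom_def)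
  then show ?thesis
    using inj_on_imp_bij_betw[OF inj_on_subset[OF inj X]] by (auto simp: ua_isomorphic_def)
qed

section \<open>Copies of an algebra\<close>

lemma copies_subset_Pow: "copies S C D \<subseteq> Pow (carrier C)"
  by (auto simp: copies_def is_subalgebra_def)

lemma finite_copies: "finite (carrier C) \<Longrightarrow> finite (copies S C D)"
  using finite_subset[OF copies_subset_Pow] by simp

lemma copies_self: "is_subalgebra S X C \<Longrightarrow> X \<in> copies S C (subalg C X)"
  by (simp add: copies_def ua_isomorphic_refl)

text \<open>An orbit is defined by an action on the copies of its own representative; this puts
  the orbits of all the representatives into one and the same action.\<close>

lemma copies_subalg_eq:
  assumes "X \<in> copies S C D"
  shows "copies S C (subalg C X) = copies S C D"
proof -
  have "ua_isomorphic S (subalg C X) D" "ua_isomorphic S D (subalg C X)"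
    using assms ua_isomorphic_sym[OF ualgebra_subalg] by (auto simp: copies_def)
  then show ?thesis
    by (auto simp: copies_def intro: ua_isomorphic_trans)
qed

lemma image_in_copies:
  assumes h: "h \<in> ua_hom S A B" and inj: "inj_on h (carrier A)" and X: "X \<in> copies S A D"
  shows "h ` X \<in> copies S B D"
proof -
  have sub: "is_subalgebra S X A" and iso: "ua_isomorphic S (subalg A X) D"
    using X by (auto simp: copies_def)
  have "ua_isomorphic S (subalg A X) (subalg B (h ` X))"
    using subalg_isomorphic_image[OF h inj is_subalgebra_subset[OF sub]] .
  then have "ua_isomorphic S (subalg B (h ` X)) D"
    using ua_isomorphic_sym[OF ualgebra_subalg[OF sub]] ua_isomorphic_trans iso by blast
  then show ?thesis
    using is_subalgebra_image[OF h sub] by (simp add: copies_def)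
qed

text \<open>Applied to an isomorphism between two copies of \<open>B\<close>, this shows that \<open>\<H>\<^sub>B(A)\<close> does not depend
  on the copy; applied to an automorphism, it shows that automorphisms permute the copies of a
  given algebra.\<close>

lemma bij_betw_copies:
  assumes A: "ualgebra S A" and h: "h \<in> ua_hom S A B"
    and bij: "bij_betw h (carrier A) (carrier B)"
  shows "bij_betw (image h) (copies S A D) (copies S B D)"
proof -
  let ?k = "inv_into (carrier A) h"
  have k: "?k \<in> ua_hom S B A" "inj_on ?k (carrier B)"
    using ua_hom_inv_into[OF A h bij] bij_betw_inv_into[OF bij] by (auto simp: bij_betw_def)
  have inj: "inj_on h (carrier A)" and onto: "h ` carrier A = carrier B"
    using bij by (auto simp: bij_betw_def)
  show ?thesis
  proof (rule bij_betw_byWitness[where f' = "image ?k"])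
    show "\<forall>X\<in>copies S A D. ?k ` h ` X = X"
      using copies_subset_Pow[of S A D] inv_into_image_cancel[OF inj] by (simp add: subset_iff)
    show "\<forall>Y\<in>copies S B D. h ` ?k ` Y = Y"
      using copies_subset_Pow[of S B D] image_inv_into_cancel[OF onto] by (simp add: subset_iff)
    show "image h ` copies S A D \<subseteq> copies S B D"
      using image_in_copies[OF h inj] by blast
    show "image ?k ` copies S B D \<subseteq> copies S A D"
      using image_in_copies[OF k] by blast
  qed
qed

lemma hasse_eq_of_isomorphic:
  assumes "ualgebra S B" and "ua_isomorphic S B B'"
  shows "hasse S B D = hasse S B' D"
  using assms bij_betw_copies bij_betw_same_card unfolding ua_isomorphic_def hasse_def by blast

section \<open>The action of the automorphism group\<close>

lemma carrier_ua_Aut: "carrier (ua_Aut S C) = ua_hom S C C \<inter> Bij (carrier C)"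
  by (simp add: ua_Aut_def)

lemma restrict_ua_hom:
  assumes "ualgebra S A" and "h \<in> ua_hom S A B"
  shows "restrict h (carrier A) \<in> ua_hom S A B"
proof -
  have "map (restrict h (carrier A)) xs = map h xs" if "xs \<in> args S f (carrier A)" for f xs
    using that by (auto simp: args_def)
  then show ?thesis
    using assms by (auto simp: ua_hom_def ualgebra_def simp del: map_eq_conv)
qed

lemma subgroup_ua_Aut:
  assumes C: "ualgebra S C"
  shows "subgroup (carrier (ua_Aut S C)) (BijGroup (carrier C))"
  unfolding carrier_ua_Aut
proof (rule subgroup.intro)
  show "ua_hom S C C \<inter> Bij (carrier C) \<subseteq> carrier (BijGroup (carrier C))"
    by (simp add: BijGroup_def)
next
  fix g h assume g: "g \<in> ua_hom S C C \<inter> Bij (carrier C)"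
    and h: "h \<in> ua_hom S C C \<inter> Bij (carrier C)"
  then have "restrict (g \<circ> h) (carrier C) \<in> ua_hom S C C"
    using restrict_ua_hom[OF C] ua_hom_comp by blast
  then show "g \<otimes>\<^bsub>BijGroup (carrier C)\<^esub> h \<in> ua_hom S C C \<inter> Bij (carrier C)"
    using g h compose_Bij by (auto simp: BijGroup_def compose_def comp_def)
next
  have "id \<in> ua_hom S C C"
    by (auto simp: ua_hom_def)
  then have "restrict id (carrier C) \<in> ua_hom S C C"
    by (rule restrict_ua_hom[OF C])
  then show "\<one>\<^bsub>BijGroup (carrier C)\<^esub> \<in> ua_hom S C C \<inter> Bij (carrier C)"
    using id_Bij by (simp add: BijGroup_def id_def)
next
  fix h assume h: "h \<in> ua_hom S C C \<inter> Bij (carrier C)"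
  then have "bij_betw h (carrier C) (carrier C)"
    by (simp add: Bij_def)
  with h show "inv\<^bsub>BijGroup (carrier C)\<^esub> h \<in> ua_hom S C C \<inter> Bij (carrier C)"
    using restrict_ua_hom[OF C ua_hom_inv_into[OF C]] restrict_inv_into_Bij[of h]
    by (simp add: inv_BijGroup del: restrict_apply)
qed

lemma ua_Aut_inj_on: "h \<in> carrier (ua_Aut S C) \<Longrightarrow> inj_on h (carrier C)"
  by (simp add: carrier_ua_Aut Bij_def bij_betw_def)

lemma aut_action_apply:
  "Y \<in> copies S C (subalg C X) \<Longrightarrow> aut_action S C X h Y = h ` Y"
  by (simp add: aut_action_def)

lemma group_action_aut_action:
  assumes C: "ualgebra S C"
  shows "group_action (ua_Aut S C) (copies S C (subalg C X)) (aut_action S C X)"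
proof -
  let ?E = "copies S C (subalg C X)" and ?G = "ua_Aut S C"
  have sub: "Y \<subseteq> carrier C" if "Y \<in> ?E" for Y
    using that copies_subset_Pow by blast
  have "group ?G"
    using subgroup.subgroup_is_group[OF subgroup_ua_Aut[OF C] group_BijGroup]
    by (simp add: ua_Aut_def)
  have Bij: "aut_action S C X h \<in> Bij ?E" if "h \<in> carrier ?G" for h
  proof -
    have "bij_betw (image h) ?E ?E"
      using that by (intro bij_betw_copies[OF C]) (auto simp: carrier_ua_Aut Bij_def)
    then show ?thesis
      by (auto simp: Bij_def aut_action_def bij_betw_restrict_eq cong: bij_betw_cong)
  qed
  have mult: "aut_action S C X (g \<otimes>\<^bsub>?G\<^esub> h) =
      aut_action S C X g \<otimes>\<^bsub>BijGroup ?E\<^esub> aut_action S C X h"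
    if g: "g \<in> carrier ?G" and h: "h \<in> carrier ?G" for g h
  proof
    fix Y
    have mult_gh: "g \<otimes>\<^bsub>?G\<^esub> h = compose (carrier C) g h"
      using g h by (simp add: ua_Aut_def BijGroup_def)
    show "aut_action S C X (g \<otimes>\<^bsub>?G\<^esub> h) Y =
        (aut_action S C X g \<otimes>\<^bsub>BijGroup ?E\<^esub> aut_action S C X h) Y"
    proof (cases "Y \<in> ?E")
      case True
      then have "h ` Y \<in> ?E"
        using h ua_Aut_inj_on[OF h] by (auto simp: carrier_ua_Aut intro: image_in_copies)
      moreover have "compose (carrier C) g h ` Y = g ` h ` Y"
        using sub[OF True] by (force simp: compose_def)
      ultimately show ?thesis
        using True Bij[OF g] Bij[OF h]
        by (simp add: mult_gh BijGroup_def compose_eq aut_action_apply)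
    next
      case False
      \<comment> \<open>Both sides are extensional on the set of copies, so both are undefined here.\<close>
      then show ?thesis
        using Bij[OF g] Bij[OF h] by (simp add: BijGroup_def compose_def aut_action_def)
    qed
  qed
  have "aut_action S C X \<in> hom ?G (BijGroup ?E)"
    using Bij mult by (auto simp: hom_def BijGroup_def)
  then show ?thesis
    using \<open>group ?G\<close> group_BijGroup
    by (simp add: group_action_def group_hom_def group_hom_axioms_def)
qed

lemma aut_orbit_eq:
  assumes "Y \<in> copies S C (subalg C X)"
  shows "aut_orbit S C Y = orbit (ua_Aut S C) (aut_action S C X) Y"
  unfolding aut_orbit_def aut_action_def copies_subalg_eq[OF assms] ..

lemma aut_orbit_invariant:
  assumes C: "ualgebra S C" and X: "is_subalgebra S X C"
    and Y: "Y \<in> aut_orbit S C X" and h: "h \<in> carrier (ua_Aut S C)"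
  shows "h ` Y \<in> aut_orbit S C X"
proof -
  interpret group_action "ua_Aut S C" "copies S C (subalg C X)" "aut_action S C X"
    by (rule group_action_aut_action[OF C])
  note X' = copies_self[OF X]
  have Y': "Y \<in> copies S C (subalg C X)"
    using Y orbit_subset[OF X'] by (auto simp: aut_orbit_def)
  have hY: "aut_action S C X h Y = h ` Y"
    using aut_action_apply[OF Y'] .
  have "h ` Y \<in> orbit (ua_Aut S C) (aut_action S C X) Y"
    using h hY by (auto simp: orbit_def)
  then show ?thesis
    using orbit_trans[OF X' Y' element_image[OF h Y' hY]] Y by (simp add: aut_orbit_def)
qed

lemma aut_orbit_subset_copies:
  assumes "ualgebra S C" and "is_subalgebra S X C"
  shows "aut_orbit S C X \<subseteq> copies S C (subalg C X)"
  unfolding aut_orbit_def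
  using group_action.orbit_subset[OF group_action_aut_action[OF assms(1)] copies_self[OF assms(2)]] .

lemma orbit_representatives_bij_betw:
  assumes "orbit_representatives S C X Xs k"
  shows "bij_betw (\<lambda>i. orbit (ua_Aut S C) (aut_action S C X) (Xs i)) {1..k} (aut_orbits S C X)"
proof -
  have "aut_orbit S C (Xs i) = orbit (ua_Aut S C) (aut_action S C X) (Xs i)" if "i \<in> {1..k}" for i
    using assms that by (intro aut_orbit_eq) (simp add: orbit_representatives_def)
  then have "bij_betw (\<lambda>i. aut_orbit S C (Xs i)) {1..k} (aut_orbits S C X) \<longleftrightarrow> ?thesis"
    by (rule bij_betw_cong)
  with assms show ?thesis
    by (simp add: orbit_representatives_def)
qed

lemma sum_over_copies:
  assumes C: "ualgebra S C" "finite (carrier C)" and reps: "orbit_representatives S C X Xs k"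
  shows "sum f (copies S C (subalg C X)) = (\<Sum>i = 1..k. sum f (aut_orbit S C (Xs i)))"
proof -
  have "sum f (copies S C (subalg C X)) =
      (\<Sum>i = 1..k. sum f (orbit (ua_Aut S C) (aut_action S C X) (Xs i)))"
    using group_action.sum_by_orbit_representatives[OF group_action_aut_action[OF C(1)]
        finite_copies[OF C(2)] orbit_representatives_bij_betw[OF reps, unfolded aut_orbits_def]] .
  also have "\<dots> = (\<Sum>i = 1..k. sum f (aut_orbit S C (Xs i)))"
    using reps aut_orbit_eq by (intro sum.cong) (fastforce simp: orbit_representatives_def)+
  finally show ?thesis .
qed

lemma aut_transitive_iff:
  assumes C: "ualgebra S C" and X: "is_subalgebra S X C"
    and reps: "orbit_representatives S C X Xs k"
  shows "aut_transitive S C X \<longleftrightarrow> k = 1"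
proof -
  have "card (aut_orbits S C X) = k"
    using bij_betw_same_card[OF orbit_representatives_bij_betw[OF reps]] by simp
  then show ?thesis
    using group_action.transitive_iff_card_orbits[OF group_action_aut_action[OF C]] copies_self[OF X]
    unfolding aut_transitive_def aut_orbits_def by blast
qed

lemma aut_orbit_eq_copies:
  assumes C: "ualgebra S C" and trans: "aut_transitive S C X"
    and Y: "Y \<in> copies S C (subalg C X)"
  shows "aut_orbit S C Y = copies S C (subalg C X)"
proof -
  let ?E = "copies S C (subalg C X)"
  interpret group_action "ua_Aut S C" ?E "aut_action S C X"
    by (rule group_action_aut_action[OF C])
  have "card (orbits (ua_Aut S C) ?E (aut_action S C X)) = 1"
    using trans Y transitive_iff_card_orbits by (auto simp: aut_transitive_def)
  then show ?thesis
    using orbit_eq_of_card_orbits_1[OF _ Y] aut_orbit_eq[OF Y] by simp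
qed

lemma orbit_representatives_transitive:
  assumes C: "ualgebra S C" and X: "is_subalgebra S X C" and trans: "aut_transitive S C X"
  shows "orbit_representatives S C X (\<lambda>_. X) 1"
proof -
  note X' = copies_self[OF X]
  have "card (aut_orbits S C X) = 1"
    using trans X' group_action.transitive_iff_card_orbits[OF group_action_aut_action[OF C]]
    unfolding aut_transitive_def aut_orbits_def by blast
  moreover have "aut_orbit S C X \<in> aut_orbits S C X"
    using X' by (auto simp: aut_orbit_def aut_orbits_def orbits_def)
  ultimately have "aut_orbits S C X = {aut_orbit S C X}"
    by (auto simp: card_1_singleton_iff)
  then show ?thesis
    using X' by (auto simp: orbit_representatives_def bij_betw_def)
qed

section \<open>Counting incident pairs\<close>

lemma hasse_over_eq_card:
  assumes "is_subalgebra S A C"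
  shows "hasse_over S C A D = card {B\<^sub>0 \<in> copies S C D. A \<subseteq> B\<^sub>0}"
proof -
  have "is_subalgebra S A (subalg C B\<^sub>0) \<longleftrightarrow> A \<subseteq> B\<^sub>0" if "is_subalgebra S B\<^sub>0 C" for B\<^sub>0
    using is_subalgebra_of_subalg[OF is_subalgebra_subset[OF that]] assms by blast
  then show ?thesis
    unfolding hasse_over_def copies_def by (intro arg_cong[where f = card]) auto
qed

lemma hasse_over_star_eq_card:
  assumes C: "ualgebra S C" and A: "is_subalgebra S A C" and B: "is_subalgebra S B C"
  shows "hasse_over_star S C A B = card {B\<^sub>0 \<in> aut_orbit S C B. A \<subseteq> B\<^sub>0}"
proof -
  have orbit: "is_subalgebra S B\<^sub>0 C" if "B\<^sub>0 \<in> aut_orbit S C B" for B\<^sub>0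
    using that aut_orbit_subset_copies[OF C B] by (auto simp: copies_def)
  have "is_subalgebra S A (subalg C B\<^sub>0) \<longleftrightarrow> A \<subseteq> B\<^sub>0" if "is_subalgebra S B\<^sub>0 C" for B\<^sub>0
    using is_subalgebra_of_subalg[OF is_subalgebra_subset[OF that]] A by blast
  then show ?thesis
    unfolding hasse_over_star_def using orbit by (intro arg_cong[where f = card]) auto
qed

text \<open>An automorphism maps an invariant finite set of subalgebras injectively into itself,
  hence onto itself, and it preserves inclusion in both directions.\<close>

lemma card_above_image:
  assumes h: "h \<in> carrier (ua_Aut S C)" and "finite \<B>" and \<B>: "\<B> \<subseteq> Pow (carrier C)"
    and inv: "\<And>Y. Y \<in> \<B> \<Longrightarrow> h ` Y \<in> \<B>" and A: "A \<subseteq> carrier C"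
  shows "card {B\<^sub>0 \<in> \<B>. h ` A \<subseteq> B\<^sub>0} = card {B\<^sub>0 \<in> \<B>. A \<subseteq> B\<^sub>0}"
proof -
  have inj: "inj_on (image h) (Pow (carrier C))"
    using ua_Aut_inj_on[OF h] by (rule inj_on_image_Pow)
  have onto: "image h ` \<B> = \<B>"
    using inv inj_on_subset[OF inj \<B>] by (intro endo_inj_surj \<open>finite \<B>\<close>) auto
  have iff: "h ` A \<subseteq> h ` Y \<longleftrightarrow> A \<subseteq> Y" if "Y \<in> \<B>" for Y
  proof -
    have "Y \<subseteq> carrier C"
      using that \<B> by auto
    then show ?thesis
      using A inv_into_image_cancel[OF ua_Aut_inj_on[OF h]] by (metis image_mono)
  qed
  have "{B\<^sub>0 \<in> image h ` \<B>. h ` A \<subseteq> B\<^sub>0} = image h ` {B\<^sub>0 \<in> \<B>. h ` A \<subseteq> h ` B\<^sub>0}"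
    unfolding image_def by blast
  also have "{B\<^sub>0 \<in> \<B>. h ` A \<subseteq> h ` B\<^sub>0} = {B\<^sub>0 \<in> \<B>. A \<subseteq> B\<^sub>0}"
    using iff by (intro Collect_cong conj_cong refl)
  finally have "{B\<^sub>0 \<in> \<B>. h ` A \<subseteq> B\<^sub>0} = image h ` {B\<^sub>0 \<in> \<B>. A \<subseteq> B\<^sub>0}"
    unfolding onto .
  moreover have "inj_on (image h) {B\<^sub>0 \<in> \<B>. A \<subseteq> B\<^sub>0}"
    using \<B> by (intro inj_on_subset[OF inj]) auto
  ultimately show ?thesis
    by (simp add: card_image)
qed

text \<open>Both sides count the pairs \<open>X \<subseteq> B\<^sub>0\<close> with \<open>X\<close> a copy of \<open>A\<close> and \<open>B\<^sub>0 \<in> \<B>\<close>: the left side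
  groups them by \<open>B\<^sub>0\<close>, the right side by the orbit of \<open>X\<close>.\<close>

lemma count_copies_below_invariant_set:
  assumes C: "ualgebra S C" "finite (carrier C)"
    and reps: "orbit_representatives S C A As m"
    and \<B>: "\<B> \<subseteq> copies S C (subalg C B)"
    and inv: "\<And>h Y. h \<in> carrier (ua_Aut S C) \<Longrightarrow> Y \<in> \<B> \<Longrightarrow> h ` Y \<in> \<B>"
  shows "hasse S (subalg C B) (subalg C A) * card \<B> =
    (\<Sum>i = 1..m. card (aut_orbit S C (As i)) * card {B\<^sub>0 \<in> \<B>. As i \<subseteq> B\<^sub>0})"
proof -
  let ?E = "copies S C (subalg C A)"
  let ?above = "\<lambda>X. card {B\<^sub>0 \<in> \<B>. X \<subseteq> B\<^sub>0}"
  have fin: "finite \<B>"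
    using \<B> finite_copies[OF C(2)] by (rule finite_subset)
  have below: "card {X \<in> ?E. X \<subseteq> B\<^sub>0} = hasse S (subalg C B) (subalg C A)" if "B\<^sub>0 \<in> \<B>" for B\<^sub>0
  proof -
    have B\<^sub>0: "is_subalgebra S B\<^sub>0 C" "ua_isomorphic S (subalg C B\<^sub>0) (subalg C B)"
      using that \<B> by (auto simp: copies_def)
    have "copies S (subalg C B\<^sub>0) (subalg C A) = {X \<in> ?E. X \<subseteq> B\<^sub>0}"
      using is_subalgebra_of_subalg[OF is_subalgebra_subset[OF B\<^sub>0(1)]] by (auto simp: copies_def)
    then show ?thesis
      using hasse_eq_of_isomorphic[OF ualgebra_subalg[OF B\<^sub>0(1)] B\<^sub>0(2), of "subalg C A"]
      by (simp add: hasse_def)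
  qed
  have const: "?above X = ?above (As i)" if i: "i \<in> {1..m}" and X: "X \<in> aut_orbit S C (As i)" for i X
  proof -
    have Ai: "As i \<in> ?E"
      using reps i by (simp add: orbit_representatives_def)
    from X obtain h where h: "h \<in> carrier (ua_Aut S C)" "X = h ` As i"
      unfolding aut_orbit_eq[OF Ai] orbit_def using aut_action_apply[OF Ai] by auto
    have "\<B> \<subseteq> Pow (carrier C)" "As i \<subseteq> carrier C"
      using \<B> Ai copies_subset_Pow by blast+
    with card_above_image[OF h(1) fin _ inv[OF h(1)]] h(2) show ?thesis
      by simp
  qed
  have "hasse S (subalg C B) (subalg C A) * card \<B> = (\<Sum>X\<in>?E. ?above X)"
    using sum_multicount[OF finite_copies[OF C(2)] fin, where R = "(\<subseteq>)"] below
    by (intro sym[of "sum ?above ?E"]) blast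
  also have "\<dots> = (\<Sum>i = 1..m. sum ?above (aut_orbit S C (As i)))"
    by (rule sum_over_copies[OF C reps])
  also have "\<dots> = (\<Sum>i = 1..m. card (aut_orbit S C (As i)) * ?above (As i))"
    using const by simp
  finally show ?thesis .
qed

theorem proposition2p3:
  fixes S :: "'f signature" and C :: "('a, 'f) ualg"
    and A B :: "'a set" and As Bs :: "nat \<Rightarrow> 'a set" and m n :: nat
  assumes "ualgebra S C" and "finite (carrier C)"
    and "is_subalgebra S A C" and "is_subalgebra S B C"
    and "orbit_representatives S C A As m"
    and "orbit_representatives S C B Bs n"
  shows "hasse_over S C A (subalg C B) = (\<Sum>j = 1..n. hasse_over_star S C A (Bs j)) \<and>
    hasse S (subalg C B) (subalg C A) * card (aut_orbit S C B) =
      (\<Sum>i = 1..m. card (aut_orbit S C (As i)) * hasse_over_star S C (As i) B) \<and>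
    hasse S (subalg C B) (subalg C A) * hasse S C (subalg C B) =
      (\<Sum>i = 1..m. card (aut_orbit S C (As i)) * hasse_over S C (As i) (subalg C B)) \<and>
    (aut_transitive S C B \<longleftrightarrow> n = 1) \<and>
    (aut_transitive S C B \<longrightarrow>
      card (aut_orbit S C B) = hasse S C (subalg C B) \<and>
      (\<forall>i \<in> {1..m}. hasse_over_star S C (As i) B = hasse_over S C (As i) (subalg C B))) \<and>
    (aut_transitive S C A \<longleftrightarrow> m = 1) \<and>
    (aut_transitive S C A \<longrightarrow>
      hasse S (subalg C B) (subalg C A) * card (aut_orbit S C B) =
        hasse S C (subalg C A) * hasse_over_star S C A B \<and>
      hasse S (subalg C B) (subalg C A) * hasse S C (subalg C B) =
        hasse S C (subalg C A) * hasse_over S C A (subalg C B))"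
proof -
  note C = \<open>ualgebra S C\<close> \<open>finite (carrier C)\<close>
  note A = \<open>is_subalgebra S A C\<close> and B = \<open>is_subalgebra S B C\<close>
  note repsA = \<open>orbit_representatives S C A As m\<close> and repsB = \<open>orbit_representatives S C B Bs n\<close>
  let ?EB = "copies S C (subalg C B)"
  have As: "is_subalgebra S (As i) C" if "i \<in> {1..m}" for i
    using repsA that by (auto simp: orbit_representatives_def copies_def)
  have Bs: "is_subalgebra S (Bs j) C" if "j \<in> {1..n}" for j
    using repsB that by (auto simp: orbit_representatives_def copies_def)
  have over: "hasse_over S C X (subalg C B) = card {B\<^sub>0 \<in> ?EB. X \<subseteq> B\<^sub>0}"
    if "is_subalgebra S X C" for X
    using hasse_over_eq_card[OF that] .
  have over_star: "hasse_over_star S C X Y = card {B\<^sub>0 \<in> aut_orbit S C Y. X \<subseteq> B\<^sub>0}"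
    if "is_subalgebra S X C" "is_subalgebra S Y C" for X Y
    using hasse_over_star_eq_card[OF C(1) that] .
  have fin_orbit: "finite (aut_orbit S C Y)" if "is_subalgebra S Y C" for Y
    using finite_subset[OF aut_orbit_subset_copies[OF C(1) that] finite_copies[OF C(2)]] .

  have "hasse_over S C A (subalg C B) = (\<Sum>B\<^sub>0\<in>?EB. if A \<subseteq> B\<^sub>0 then 1 else 0)"
    using card_as_sums[OF refl finite_copies[OF C(2)]] by (simp add: over[OF A])
  also have "\<dots> = (\<Sum>j = 1..n. \<Sum>B\<^sub>0\<in>aut_orbit S C (Bs j). if A \<subseteq> B\<^sub>0 then 1 else 0)"
    by (rule sum_over_copies[OF C repsB])
  also have "\<dots> = (\<Sum>j = 1..n. hasse_over_star S C A (Bs j))"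
    using card_as_sums[OF refl fin_orbit[OF Bs]] by (intro sum.cong) (simp_all add: over_star[OF A Bs])
  finally have 1: "hasse_over S C A (subalg C B) = (\<Sum>j = 1..n. hasse_over_star S C A (Bs j))" .

  \<comment> \<open>Stated for arbitrary representatives, since in the transitive case \<open>A\<close> itself is used as the
    only one.\<close>
  have 2: "hasse S (subalg C B) (subalg C A) * card (aut_orbit S C B) =
      (\<Sum>i = 1..k. card (aut_orbit S C (Rs i)) * hasse_over_star S C (Rs i) B)"
    if reps: "orbit_representatives S C A Rs k" for Rs k
  proof -
    have "is_subalgebra S (Rs i) C" if "i \<in> {1..k}" for i
      using reps that by (auto simp: orbit_representatives_def copies_def)
    moreover have "hasse S (subalg C B) (subalg C A) * card (aut_orbit S C B) =
        (\<Sum>i = 1..k. card (aut_orbit S C (Rs i)) * card {B\<^sub>0 \<in> aut_orbit S C B. Rs i \<subseteq> B\<^sub>0})"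
      using aut_orbit_invariant[OF C(1) B]
      by (intro count_copies_below_invariant_set[OF C reps aut_orbit_subset_copies[OF C(1) B]])
    ultimately show ?thesis
      by (simp add: over_star B)
  qed

  have 3: "hasse S (subalg C B) (subalg C A) * hasse S C (subalg C B) =
      (\<Sum>i = 1..k. card (aut_orbit S C (Rs i)) * hasse_over S C (Rs i) (subalg C B))"
    if reps: "orbit_representatives S C A Rs k" for Rs k
  proof -
    have "is_subalgebra S (Rs i) C" if "i \<in> {1..k}" for i
      using reps that by (auto simp: orbit_representatives_def copies_def)
    moreover have "h ` Y \<in> ?EB" if "h \<in> carrier (ua_Aut S C)" "Y \<in> ?EB" for h Y
      using that ua_Aut_inj_on[OF that(1)] by (auto simp: carrier_ua_Aut intro: image_in_copies)
    then have "hasse S (subalg C B) (subalg C A) * card ?EB =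
        (\<Sum>i = 1..k. card (aut_orbit S C (Rs i)) * card {B\<^sub>0 \<in> ?EB. Rs i \<subseteq> B\<^sub>0})"
      by (intro count_copies_below_invariant_set[OF C reps subset_refl])
    ultimately show ?thesis
      by (simp add: over hasse_def)
  qed

  have transB: "card (aut_orbit S C B) = hasse S C (subalg C B) \<and>
      (\<forall>i \<in> {1..m}. hasse_over_star S C (As i) B = hasse_over S C (As i) (subalg C B))"
    if "aut_transitive S C B"
    using aut_orbit_eq_copies[OF C(1) that copies_self[OF B]]
    by (simp add: over over_star As B hasse_def)

  have transA: "hasse S (subalg C B) (subalg C A) * card (aut_orbit S C B) =
        hasse S C (subalg C A) * hasse_over_star S C A B \<and>
      hasse S (subalg C B) (subalg C A) * hasse S C (subalg C B) =
        hasse S C (subalg C A) * hasse_over S C A (subalg C B)"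
    if trans: "aut_transitive S C A"
    using 2[OF orbit_representatives_transitive[OF C(1) A trans]]
      3[OF orbit_representatives_transitive[OF C(1) A trans]]
      aut_orbit_eq_copies[OF C(1) trans copies_self[OF A]]
    by (simp add: hasse_def)

  show ?thesis
    by (intro conjI[OF 1] conjI[OF 2[OF repsA]] conjI[OF 3[OF repsA]]
        conjI[OF aut_transitive_iff[OF C(1) B repsB]] conjI[OF aut_transitive_iff[OF C(1) A repsA]]
        conjI impI transA transB)
qed

end
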